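(* Let $f\in C^1[0,1]$ and $A\subseteq[0,1]$. If $f|_A$ is convex (or concave), then there is a set $B\subseteq[0,1]$ such that $f'|_B$ is monotone and $$\dim_H B\ge\dim_H A,\qquad \overline{\dim}_M B\ge\overline{\dim}_M A\quad\text{and}\quad \underline{\dim}_M B\ge\underline{\dim}_M A.$$
   Context: $C^1[0,1]$ is the set of continuously differentiable functions $f:[0,1]\to\mathbb R$. For $A\subseteq[0,1]$, $f|_A$ is convex if for all $x_1<x_2<x_3$ in $A$ one has $\frac{f(x_2)-f(x_1)}{x_2-x_1}\le\frac{f(x_3)-f(x_2)}{x_3-x_2}$, and concave if the reverse inequality always holds. Monotone means (not necessarily strictly) monotone increasing or monotone decreasing. $\dim_H$ denotes Hausdorff dimension. For $A\subseteq[0,1]$ and an integer $k\ge2$ let $\mathcal N_{k,\ell}(A)=\#\{j\in\mathbb Z: A\cap[\frac{j-1}{k^\ell},\frac{j}{k^\ell}]\ne\emptyset\}$. The upper and lower Minkowski (box) dimensions are $\overline{\dim}_M A=\limsup_{\ell\to\infty}\frac{\log\mathcal N_{k,\ell}(A)}{\ell\log k}$ and $\underline{\dim}_M A=\liminf_{\ell\to\infty}\frac{\log\mathcal N_{k,\ell}(A)}{\ell\log k}$; they do not depend on $k$. *)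

theory Defs
  imports "HOL-Analysis.Analysis"
begin

text \<open>
  The library's \<open>convex_on\<close> requires a convex domain; here the domain is an arbitrary set,
  so convexity is stated through increasing difference quotients.
\<close>

definition slope_convex_on :: "real set \<Rightarrow> (real \<Rightarrow> real) \<Rightarrow> bool" where
  "slope_convex_on A f \<longleftrightarrow>
     (\<forall>x1\<in>A. \<forall>x2\<in>A. \<forall>x3\<in>A. x1 < x2 \<longrightarrow> x2 < x3 \<longrightarrow>
        (f x2 - f x1) / (x2 - x1) \<le> (f x3 - f x2) / (x3 - x2))"

definition slope_concave_on :: "real set \<Rightarrow> (real \<Rightarrow> real) \<Rightarrow> bool" where
  "slope_concave_on A f \<longleftrightarrow>
     (\<forall>x1\<in>A. \<forall>x2\<in>A. \<forall>x3\<in>A. x1 < x2 \<longrightarrow> x2 < x3 \<longrightarrow>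
        (f x2 - f x1) / (x2 - x1) \<ge> (f x3 - f x2) / (x3 - x2))"

text \<open>
  The sets of a cover are required to be bounded because \<open>diameter\<close> is unspecified on
  unbounded sets. Empty sets are allowed, so finite covers are included. The exponent is meant
  to be positive: \<open>0 powr 0 = 0\<close> would give the wrong value for exponent \<open>0\<close>.
\<close>

definition hausdorff_content :: "real \<Rightarrow> real \<Rightarrow> 'a::metric_space set \<Rightarrow> ennreal" where
  "hausdorff_content s \<delta> A =
     (INF U \<in> {U :: nat \<Rightarrow> 'a set. A \<subseteq> (\<Union>i. U i) \<and> (\<forall>i. bounded (U i) \<and> diameter (U i) \<le> \<delta>)}.
        \<Sum>i. ennreal (diameter (U i) powr s))"

definition hausdorff_measure :: "real \<Rightarrow> 'a::metric_space set \<Rightarrow> ennreal" where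
  "hausdorff_measure s A = (SUP \<delta> \<in> {0<..}. hausdorff_content s \<delta> A)"

text \<open>
  Leaving out the exponent \<open>0\<close> does not change the infimum; the empty set has dimension \<open>0\<close>.
\<close>

definition hausdorff_dim :: "'a::metric_space set \<Rightarrow> ereal" where
  "hausdorff_dim A = (INF s \<in> {s. 0 < s \<and> hausdorff_measure s A = 0}. ereal s)"

text \<open>
  The number of closed \<open>k\<close>-adic intervals of level \<open>l\<close> meeting \<open>A\<close>. It is only used for
  bounded \<open>A\<close>, for which the set of indices is finite.
\<close>

definition box_count :: "nat \<Rightarrow> nat \<Rightarrow> real set \<Rightarrow> nat" where
  "box_count k l A =
     card {j::int. A \<inter> {(real_of_int j - 1) / real k ^ l .. real_of_int j / real k ^ l} \<noteq> {}}"

text \<open>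
  The case distinction implements \<open>log 0 = -\<infinity>\<close> (whereas \<open>ln 0 = 0\<close> in the library), so
  that the empty set has box dimensions \<open>-\<infinity>\<close>.
\<close>

definition box_ratio :: "nat \<Rightarrow> nat \<Rightarrow> real set \<Rightarrow> ereal" where
  "box_ratio k l A =
     (if box_count k l A = 0 then -\<infinity>
      else ereal (ln (real (box_count k l A)) / (real l * ln (real k))))"

definition upper_box_dim :: "nat \<Rightarrow> real set \<Rightarrow> ereal" where
  "upper_box_dim k A = limsup (\<lambda>l. box_ratio k l A)"

definition lower_box_dim :: "nat \<Rightarrow> real set \<Rightarrow> ereal" where
  "lower_box_dim k A = liminf (\<lambda>l. box_ratio k l A)"

end

theory Submission
  imports Defs
begin

text \<open>
  Suppose that \<open>f\<close> is convex on \<open>A\<close>; the concave case is the convex case for \<open>- f\<close>. Moving to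
  the right along \<open>A\<close>, the slopes of chords of \<open>f\<close> between points of \<open>A\<close> increase, and \<open>f'\<close> takes
  the values of such slopes at two kinds of points. At a limit point of \<open>A\<close>, the value of \<open>f'\<close> is
  a limit of slopes of short chords nearby, because \<open>f\<close> is \<open>C\<^sup>1\<close> and not merely differentiable.
  In a gap of \<open>A\<close>, that is, between two consecutive points \<open>a < b\<close> of \<open>A\<close>, the mean value theorem
  gives points where \<open>f'\<close> equals the slope of the chord over \<open>[a, b]\<close>. Let \<open>B\<close> consist of all
  points of both kinds. Comparing chords shows that \<open>f'\<close> is increasing on \<open>B\<close>
  (\<open>mono_on_secant_points\<close>).

  The set \<open>B\<close> is large for two different reasons. All but countably many points of \<open>A\<close> are
  limit points of \<open>A\<close> and so lie in \<open>B\<close>, and countable sets do not affect the Hausdorff dimension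
  (\<open>hausdorff_dim_le_of_countable_diff\<close>). They do affect box dimensions, and this is what the
  points in the gaps are for: with them, any two points of \<open>A\<close> have a point of \<open>B\<close> between them
  (\<open>secant_points_between\<close>, by the Bolzano--Weierstrass theorem). This interleaving alone bounds
  the box counts of \<open>A\<close> by a constant multiple of those of \<open>B\<close>
  (\<open>box_count_le_of_interleaved\<close>), and a constant factor disappears in the limit.

  If \<open>A\<close> has at most one point, then \<open>B\<close> is empty and the comparison of box dimensions fails for
  a singleton; but then \<open>f'\<close> is trivially monotone on \<open>A\<close> itself.
\<close>

section \<open>Slopes of chords\<close>

definition slope :: "(real \<Rightarrow> real) \<Rightarrow> real \<Rightarrow> real \<Rightarrow> real" where
  "slope f a b = (f b - f a) / (b - a)"

lemma slope_attained:
  fixes f f' :: "real \<Rightarrow> real"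
  assumes "\<And>x. x \<in> S \<Longrightarrow> (f has_real_derivative f' x) (at x within S)"
    and "{a..b} \<subseteq> S" "a < b"
  obtains c where "a < c" "c < b" "f' c = slope f a b"
proof -
  have "(f has_derivative (*) (f' x)) (at x within {a..b})" if "a \<le> x" "x \<le> b" for x
    using has_field_derivative_subset[OF assms(1) assms(2)] that assms(2)
    by (auto simp: has_field_derivative_def)
  from mvt_simple[OF \<open>a < b\<close> this] obtain c where "c \<in> {a<..<b}" "f b - f a = f' c * (b - a)"
    by auto
  then show thesis
    using that[of c] \<open>a < b\<close> by (simp add: slope_def)
qed

lemma slope_le_of_ordered_chords:
  assumes "slope_convex_on A f" "{u, v, u', v'} \<subseteq> A" "u < v" "v \<le> u'" "u' < v'"
  shows "slope f u v \<le> slope f u' v'"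
proof (cases "v = u'")
  case True
  then show ?thesis
    using assms by (auto simp: slope_convex_on_def slope_def)
next
  case False
  then have "slope f u v \<le> slope f v u'" "slope f v u' \<le> slope f u' v'"
    using assms by (auto simp: slope_convex_on_def slope_def)
  then show ?thesis
    by simp
qed

text \<open>
  An endpoint of one gap of \<open>A\<close> cannot lie inside another gap, so two gaps that contain points
  \<open>s < t\<close> either coincide or come in the order of \<open>s\<close> and \<open>t\<close>.
\<close>

lemma gaps_equal_or_ordered:
  fixes A :: "'a::linorder set"
  assumes "{a, b, a', b'} \<subseteq> A" "A \<inter> {a<..<b} = {}" "A \<inter> {a'<..<b'} = {}"
    and "a < s" "s < b" "a' < t" "t < b'" "s < t"
  shows "b \<le> a' \<or> a = a' \<and> b = b'"
proof -
  have "a' \<notin> {a<..<b}" "b' \<notin> {a<..<b}" "a \<notin> {a'<..<b'}" "b \<notin> {a'<..<b'}"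
    using assms by blast+
  then show ?thesis
    using assms(4-) by force
qed

section \<open>The set where the derivative is monotone\<close>

text \<open>
  The limit points need not belong to \<open>A\<close>, so that no closure of \<open>A\<close> has to be taken. In a gap,
  \<^emph>\<open>all\<close> points with the right value of \<open>f'\<close> are taken: \<open>f'\<close> is constant on them, and no choice is
  made.
\<close>

definition secant_points :: "(real \<Rightarrow> real) \<Rightarrow> (real \<Rightarrow> real) \<Rightarrow> real set \<Rightarrow> real set" where
  "secant_points f f' A = {t. t islimpt A} \<union>
     {t. \<exists>a\<in>A. \<exists>b\<in>A. a < t \<and> t < b \<and> A \<inter> {a<..<b} = {} \<and> f' t = slope f a b}"

lemma secant_points_subset:
  assumes "A \<subseteq> {l..r}"
  shows "secant_points f f' A \<subseteq> {l..r}"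
proof -
  have "t \<in> {l..r}" if "t islimpt A" for t
    using closed_limpt[of "{l..r}"] islimpt_subset[OF that assms] by blast
  then show ?thesis
    using assms by (force simp: secant_points_def)
qed

text \<open>
  The chord joins two points of \<open>A\<close> near \<open>t\<close> that may both lie on the same side of \<open>t\<close>, so its slope
  is compared with \<open>f' t\<close> through an intermediate value \<open>f' c\<close> and the continuity of \<open>f'\<close> at \<open>t\<close>.
\<close>

lemma derivative_at_limit_point:
  fixes f f' :: "real \<Rightarrow> real"
  assumes deriv: "\<And>x. x \<in> {l..r} \<Longrightarrow> (f has_real_derivative f' x) (at x within {l..r})"
    and cont: "continuous_on {l..r} f'"
    and "A \<subseteq> {l..r}" "t islimpt A" "0 < e" "0 < d"
  obtains u v where "u \<in> A" "v \<in> A" "u < v" "\<bar>u - t\<bar> < d" "\<bar>v - t\<bar> < d"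
    "\<bar>slope f u v - f' t\<bar> < e"
proof -
  have "t \<in> {l..r}"
    using closed_limpt[of "{l..r}"] islimpt_subset[OF \<open>t islimpt A\<close> \<open>A \<subseteq> {l..r}\<close>] by blast
  with cont \<open>0 < e\<close> obtain \<delta> where \<delta>: "0 < \<delta>"
      "\<And>x. x \<in> {l..r} \<Longrightarrow> \<bar>x - t\<bar> < \<delta> \<Longrightarrow> \<bar>f' x - f' t\<bar> < e"
    unfolding continuous_on_iff dist_real_def by meson
  define \<rho> where "\<rho> = min \<delta> d"
  have "infinite (A \<inter> ball t \<rho>)"
    using \<open>t islimpt A\<close> \<delta> \<open>0 < d\<close> by (simp add: islimpt_eq_infinite_ball \<rho>_def)
  then obtain p q where "p \<in> A \<inter> ball t \<rho>" "q \<in> A \<inter> ball t \<rho>" "p \<noteq> q"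
    by (metis finite.emptyI finite_insert finite_subset insertI1 subsetI)
  then obtain u v where uv: "u \<in> A" "v \<in> A" "u < v" "\<bar>u - t\<bar> < \<rho>" "\<bar>v - t\<bar> < \<rho>"
    by (cases "p < q") (auto simp: dist_real_def abs_minus_commute)
  have "{u..v} \<subseteq> {l..r}"
    using uv \<open>A \<subseteq> {l..r}\<close> by auto
  from slope_attained[OF deriv this \<open>u < v\<close>]
  obtain c where c: "u < c" "c < v" "f' c = slope f u v"
    by auto
  moreover have "c \<in> {l..r}"
    using c \<open>{u..v} \<subseteq> {l..r}\<close> by auto
  moreover have "\<bar>c - t\<bar> < \<delta>"
    using c uv by (auto simp: \<rho>_def)
  ultimately have "\<bar>slope f u v - f' t\<bar> < e"
    using \<delta>(2)[of c] by simp
  then show thesis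
    using that uv by (simp add: \<rho>_def)
qed

text \<open>
  For \<open>s < t\<close> in the set, \<open>f' s\<close> and \<open>f' t\<close> are, up to a small error, slopes of chords of which the
  first lies to the left of the second, or of one and the same chord if \<open>s\<close> and \<open>t\<close> are in the same
  gap. The four cases are the two kinds of points for each of \<open>s\<close> and \<open>t\<close>; an error occurs only at
  limit points.
\<close>

lemma mono_on_secant_points:
  fixes f f' :: "real \<Rightarrow> real"
  assumes deriv: "\<And>x. x \<in> {l..r} \<Longrightarrow> (f has_real_derivative f' x) (at x within {l..r})"
    and cont: "continuous_on {l..r} f'"
    and "A \<subseteq> {l..r}" and convex: "slope_convex_on A f"
  shows "mono_on (secant_points f f' A) f'"
proof (rule mono_onI)
  fix s t
  assume st: "s \<in> secant_points f f' A" "t \<in> secant_points f f' A" and "s \<le> t"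
  define gap where
    "gap x a b \<longleftrightarrow> a \<in> A \<and> b \<in> A \<and> a < x \<and> x < b \<and> A \<inter> {a<..<b} = {} \<and> f' x = slope f a b"
    for x a b
  have cases: "x islimpt A \<or> (\<exists>a b. gap x a b)" if "x \<in> secant_points f f' A" for x
    using that by (auto simp: secant_points_def gap_def)
  have limit: "\<exists>u v. u \<in> A \<and> v \<in> A \<and> u < v \<and> \<bar>u - x\<bar> < d \<and> \<bar>v - x\<bar> < d \<and>
      \<bar>slope f u v - f' x\<bar> < e" if "x islimpt A" "0 < e" "0 < d" for x e d
    using derivative_at_limit_point[OF deriv cont \<open>A \<subseteq> {l..r}\<close> that] by metis
  have chords: "slope f u v \<le> slope f u' v'"
    if "u \<in> A" "v \<in> A" "u' \<in> A" "v' \<in> A" "u < v" "v \<le> u'" "u' < v'" for u v u' v'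
    using slope_le_of_ordered_chords[OF convex] that by simp
  have "f' s \<le> f' t" if "s < t"
  proof (rule field_le_epsilon)
    fix e :: real
    assume "0 < e"
    then have e: "0 < e / 2"
      by simp
    consider (LL) "s islimpt A" "t islimpt A" | (LG) a b where "s islimpt A" "gap t a b"
      | (GL) a b where "gap s a b" "t islimpt A"
      | (GG) a b a' b' where "gap s a b" "gap t a' b'"
      using cases[OF st(1)] cases[OF st(2)] by blast
    then show "f' s \<le> f' t + e"
    proof cases
      case LL
      have d: "0 < (t - s) / 2"
        using \<open>s < t\<close> by simp
      obtain u v where uv: "u \<in> A" "v \<in> A" "u < v" "\<bar>v - s\<bar> < (t - s) / 2"
          "\<bar>slope f u v - f' s\<bar> < e / 2"
        using limit[OF LL(1) e d] by blast
      obtain u' v' where uv': "u' \<in> A" "v' \<in> A" "u' < v'" "\<bar>u' - t\<bar> < (t - s) / 2"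
          "\<bar>slope f u' v' - f' t\<bar> < e / 2"
        using limit[OF LL(2) e d] by blast
      have "v \<le> u'"
        using uv(4) uv'(4) unfolding abs_less_iff by argo
      then show ?thesis
        using chords[of u v u' v'] uv uv' unfolding abs_less_iff by argo
    next
      case (LG a b)
      then have "0 < b - s"
        using \<open>s < t\<close> by (simp add: gap_def)
      then obtain u v where uv: "u \<in> A" "v \<in> A" "u < v" "\<bar>v - s\<bar> < b - s"
          "\<bar>slope f u v - f' s\<bar> < e / 2"
        using limit[OF LG(1) e] by blast
      \<comment> \<open>The point \<open>v\<close> of \<open>A\<close> is less than \<open>b\<close>, hence not beyond the left end of the gap.\<close>
      have "v \<le> a"
        using uv LG(2) by (force simp: gap_def)
      then show ?thesis
        using chords[of u v a b] uv LG(2) \<open>0 < e\<close> unfolding gap_def abs_less_iff by argo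
    next
      case (GL a b)
      then have "0 < t - a"
        using \<open>s < t\<close> by (simp add: gap_def)
      then obtain u v where uv: "u \<in> A" "v \<in> A" "u < v" "\<bar>u - t\<bar> < t - a"
          "\<bar>slope f u v - f' t\<bar> < e / 2"
        using limit[OF GL(2) e] by blast
      have "b \<le> u"
        using uv GL(1) by (force simp: gap_def)
      then show ?thesis
        using chords[of a b u v] uv GL(1) \<open>0 < e\<close> unfolding gap_def abs_less_iff by argo
    next
      case (GG a b a' b')
      then have "b \<le> a' \<or> a = a' \<and> b = b'"
        using gaps_equal_or_ordered[of a b a' b' A s t] \<open>s < t\<close> by (simp add: gap_def)
      then show ?thesis
        using chords[of a b a' b'] GG \<open>0 < e\<close> by (auto simp: gap_def)
    qed
  qed
  with \<open>s \<le> t\<close> show "f' s \<le> f' t"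
    by (cases "s = t") auto
qed

text \<open>
  Either \<open>A\<close> has a limit point in \<open>[x, y]\<close>, or \<open>A \<inter> [x, y]\<close> is finite; then \<open>x\<close> has a next point
  \<open>b \<le> y\<close> in \<open>A\<close>, and the mean value theorem applies to the gap between \<open>x\<close> and \<open>b\<close>.
\<close>

lemma secant_points_between:
  fixes f f' :: "real \<Rightarrow> real"
  assumes deriv: "\<And>x. x \<in> {l..r} \<Longrightarrow> (f has_real_derivative f' x) (at x within {l..r})"
    and "A \<subseteq> {l..r}" "x \<in> A" "y \<in> A" "x < y"
  shows "\<exists>c \<in> secant_points f f' A. x \<le> c \<and> c \<le> y"
proof (cases "\<exists>t \<in> {x..y}. t islimpt A")
  case True
  then show ?thesis
    by (auto simp: secant_points_def)
next
  case False
  then have "finite (A \<inter> {x..y})"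
    using Heine_Borel_imp_Bolzano_Weierstrass[of "{x..y}" "A \<inter> {x..y}"]
    by (meson compact_Icc inf_le1 inf_le2 islimpt_subset)
  then have fin: "finite (A \<inter> {x<..y})"
    by (rule finite_subset[rotated]) auto
  define b where "b = Min (A \<inter> {x<..y})"
  have b: "b \<in> A \<inter> {x<..y}"
    unfolding b_def using fin assms by (intro Min_in) auto
  have gap: "A \<inter> {x<..<b} = {}"
  proof -
    have False if "z \<in> A" "x < z" "z < b" for z
      using Min_le[OF fin, of z] that b by (simp add: b_def)
    then show ?thesis
      by auto
  qed
  have "{x..b} \<subseteq> {l..r}"
    using b assms by auto
  from slope_attained[OF deriv this] b
  obtain c where "x < c" "c < b" "f' c = slope f x b"
    by auto
  then show ?thesis
    using gap b \<open>x \<in> A\<close> by (intro bexI[of _ c]) (auto simp: secant_points_def)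
qed

section \<open>Box dimensions\<close>

lemma finite_box_indices:
  assumes "bounded A" "0 < k"
  shows "finite {j::int. A \<inter> {(real_of_int j - 1) / real k ^ l .. real_of_int j / real k ^ l} \<noteq> {}}"
proof -
  obtain M where M: "\<And>x. x \<in> A \<Longrightarrow> \<bar>x\<bar> \<le> M"
    using \<open>bounded A\<close> by (auto simp: bounded_real)
  have K: "0 < real k ^ l"
    using \<open>0 < k\<close> by simp
  have "j \<in> {\<lfloor>- M * real k ^ l\<rfloor>..\<lceil>M * real k ^ l + 1\<rceil>}"
    if "A \<inter> {(real_of_int j - 1) / real k ^ l .. real_of_int j / real k ^ l} \<noteq> {}" for j
  proof -
    from that obtain x where x: "x \<in> A" "(real_of_int j - 1) / real k ^ l \<le> x"
        "x \<le> real_of_int j / real k ^ l"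
      by auto
    have "real_of_int j - 1 \<le> x * real k ^ l" "x * real k ^ l \<le> real_of_int j"
      using x(2,3) K by (simp_all add: pos_divide_le_eq pos_le_divide_eq)
    moreover have "x * real k ^ l \<le> M * real k ^ l" "- M * real k ^ l \<le> x * real k ^ l"
      using M[OF x(1)] K by (intro mult_right_mono; simp add: abs_le_iff)+
    ultimately have "real_of_int j \<le> M * real k ^ l + 1" "- M * real k ^ l \<le> real_of_int j"
      by linarith+
    then show ?thesis
      by (auto simp del: ceiling_add_one simp: floor_le_iff le_ceiling_iff)
  qed
  then show ?thesis
    by (intro finite_subset[OF _ finite_atLeastAtMost_int] subsetI) blast
qed

lemma mem_box_ceiling:
  fixes x :: real
  assumes "0 < k"
  shows "x \<in> {(real_of_int \<lceil>x * real k ^ l\<rceil> - 1) / real k ^ l .. real_of_int \<lceil>x * real k ^ l\<rceil> / real k ^ l}"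
  using \<open>0 < k\<close> ceiling_correct[of "x * real k ^ l"]
  by (auto simp: pos_divide_le_eq pos_le_divide_eq)

text \<open>
  A point on the common boundary of two closed boxes is counted in both by \<open>box_count\<close>, and two
  such boxes need not have a point of an interleaved set between them. The counting is therefore
  done with half-open boxes, where \<open>x\<close> has the single index \<open>\<lceil>x k\<^sup>l\<rceil>\<close>, monotone in \<open>x\<close>. This
  lemma and the next one show that the two ways of counting differ by a factor of at most 2.
\<close>

lemma card_ceilings_le_box_count:
  assumes "bounded A" "0 < k"
  shows "finite ((\<lambda>x. \<lceil>x * real k ^ l\<rceil>) ` A)"
    and "card ((\<lambda>x. \<lceil>x * real k ^ l\<rceil>) ` A) \<le> box_count k l A"
proof -
  have sub: "(\<lambda>x. \<lceil>x * real k ^ l\<rceil>) ` A \<subseteq>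
      {j. A \<inter> {(real_of_int j - 1) / real k ^ l .. real_of_int j / real k ^ l} \<noteq> {}}"
    using mem_box_ceiling[OF \<open>0 < k\<close>] by blast
  show "finite ((\<lambda>x. \<lceil>x * real k ^ l\<rceil>) ` A)"
    using finite_subset[OF sub finite_box_indices[OF assms]] .
  show "card ((\<lambda>x. \<lceil>x * real k ^ l\<rceil>) ` A) \<le> box_count k l A"
    unfolding box_count_def by (rule card_mono[OF finite_box_indices[OF assms] sub])
qed

lemma box_count_le_card_ceilings:
  assumes "bounded A" "0 < k"
  shows "box_count k l A \<le> 2 * card ((\<lambda>x. \<lceil>x * real k ^ l\<rceil>) ` A)"
proof -
  define I where "I = (\<lambda>x. \<lceil>x * real k ^ l\<rceil>) ` A"
  have "finite I"
    using card_ceilings_le_box_count(1)[OF assms] by (simp add: I_def)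
  have "{j. A \<inter> {(real_of_int j - 1) / real k ^ l .. real_of_int j / real k ^ l} \<noteq> {}}
      \<subseteq> I \<union> (\<lambda>i. i + 1) ` I"
  proof
    fix j
    assume "j \<in> {j. A \<inter> {(real_of_int j - 1) / real k ^ l .. real_of_int j / real k ^ l} \<noteq> {}}"
    then obtain x where x: "x \<in> A" "(real_of_int j - 1) / real k ^ l \<le> x"
        "x \<le> real_of_int j / real k ^ l"
      by auto
    have "real_of_int j - 1 \<le> x * real k ^ l" "x * real k ^ l \<le> real_of_int j"
      using x(2,3) \<open>0 < k\<close> by (simp_all add: pos_divide_le_eq pos_le_divide_eq)
    then have "\<lceil>x * real k ^ l\<rceil> = j \<or> j = \<lceil>x * real k ^ l\<rceil> + 1"
      by linarith
    then show "j \<in> I \<union> (\<lambda>i. i + 1) ` I"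
      using \<open>x \<in> A\<close> by (auto simp: I_def)
  qed
  then have "box_count k l A \<le> card (I \<union> (\<lambda>i. i + 1) ` I)"
    unfolding box_count_def using \<open>finite I\<close> by (intro card_mono) auto
  also have "\<dots> \<le> card I + card ((\<lambda>i. i + 1) ` I)"
    by (rule card_Un_le)
  also have "card ((\<lambda>i. i + 1) ` I) \<le> card I"
    using \<open>finite I\<close> by (rule card_image_le)
  finally show ?thesis
    by (simp add: I_def)
qed

text \<open>
  Charge each \<open>i \<in> I\<close> other than the last to an \<open>m \<in> J\<close> between \<open>i\<close> and its successor in \<open>I\<close>. Every
  \<open>m\<close> is charged at most twice: by \<open>m\<close> itself and by the largest element of \<open>I\<close> below \<open>m\<close>.
\<close>

lemma card_le_of_interleaved:
  fixes I J :: "'a::linorder set"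
  assumes "finite I" "finite J"
    and between: "\<And>i i'. i \<in> I \<Longrightarrow> i' \<in> I \<Longrightarrow> i < i' \<Longrightarrow> \<exists>m\<in>J. i \<le> m \<and> m \<le> i'"
  shows "card I \<le> 2 * card J + 1"
proof -
  define pred where "pred m = Max {i \<in> I. i < m}" for m
  have "I \<subseteq> insert (Max I) (J \<union> pred ` J)"
  proof
    fix i
    assume "i \<in> I"
    show "i \<in> insert (Max I) (J \<union> pred ` J)"
    proof (cases "i = Max I \<or> i \<in> J")
      case False
      then have ne: "{i' \<in> I. i < i'} \<noteq> {}"
        using \<open>i \<in> I\<close> Max_eqI[OF \<open>finite I\<close>, of i] by force
      define i' where "i' = Min {i' \<in> I. i < i'}"
      have i': "i' \<in> I" "i < i'"
        using Min_in[OF _ ne] \<open>finite I\<close> by (auto simp: i'_def)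
      have next_le: "i' \<le> z" if "z \<in> I" "i < z" for z
        using that \<open>finite I\<close> by (auto simp: i'_def intro: Min_le)
      obtain m where m: "m \<in> J" "i \<le> m" "m \<le> i'"
        using between[OF \<open>i \<in> I\<close> i'] by auto
      then have "i < m"
        using False by (auto simp: order.order_iff_strict)
      have "pred m = i"
        unfolding pred_def
      proof (rule Max_eqI)
        show "z \<le> i" if "z \<in> {i \<in> I. i < m}" for z
          using that next_le[of z] m by force
      qed (use \<open>i \<in> I\<close> \<open>i < m\<close> \<open>finite I\<close> in auto)
      then show ?thesis
        using m by auto
    qed auto
  qed
  then have "card I \<le> card (insert (Max I) (J \<union> pred ` J))"
    using \<open>finite J\<close> by (intro card_mono) auto
  also have "\<dots> \<le> Suc (card (J \<union> pred ` J))"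
    by (rule card_insert_le_m1) auto
  also have "card (J \<union> pred ` J) \<le> card J + card (pred ` J)"
    by (rule card_Un_le)
  also have "card (pred ` J) \<le> card J"
    using \<open>finite J\<close> by (rule card_image_le)
  finally show ?thesis
    by simp
qed

text \<open>
  The constant comes from \<open>2 (2 n + 1) \<le> 6 n\<close> with \<open>n \<ge> 1\<close> boxes meeting \<open>B\<close>: the outer factor 2
  accounts for closed boxes, and \<open>2 n + 1\<close> is the bound for interleaved sets of indices.
\<close>

lemma box_count_le_of_interleaved:
  assumes "bounded A" "bounded B" "B \<noteq> {}" "0 < k"
    and between: "\<And>x y. x \<in> A \<Longrightarrow> y \<in> A \<Longrightarrow> x < y \<Longrightarrow> \<exists>c\<in>B. x \<le> c \<and> c \<le> y"
  shows "box_count k l A \<le> 6 * box_count k l B"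
proof -
  define ix where "ix x = \<lceil>x * real k ^ l\<rceil>" for x
  have mono: "ix x \<le> ix y" if "x \<le> y" for x y
    using that by (auto simp: ix_def intro!: ceiling_mono mult_right_mono)
  have fin: "finite (ix ` A)" "finite (ix ` B)"
    using card_ceilings_le_box_count(1) assms by (auto simp: ix_def)
  have "card (ix ` A) \<le> 2 * card (ix ` B) + 1"
  proof (rule card_le_of_interleaved[OF fin])
    fix i i'
    assume "i \<in> ix ` A" "i' \<in> ix ` A" "i < i'"
    then obtain x y where xy: "x \<in> A" "y \<in> A" "i = ix x" "i' = ix y"
      by auto
    then have "x < y"
      using mono[of y x] \<open>i < i'\<close> by force
    then show "\<exists>m\<in>ix ` B. i \<le> m \<and> m \<le> i'"
      using between[of x y] xy mono by blast
  qed
  moreover have "box_count k l A \<le> 2 * card (ix ` A)"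
    using box_count_le_card_ceilings assms by (simp add: ix_def)
  moreover have "card (ix ` B) \<le> box_count k l B"
    using card_ceilings_le_box_count(2) assms by (simp add: ix_def)
  moreover have "0 < card (ix ` B)"
    using fin \<open>B \<noteq> {}\<close> by (simp add: card_gt_0_iff)
  ultimately show ?thesis
    by linarith
qed

text \<open>
  Taking logarithms turns the factor \<open>C\<close> into the error \<open>ln C / (l ln k)\<close>, which tends to \<open>0\<close>.
\<close>

lemma box_dims_le_of_box_count_le:
  assumes "2 \<le> k" "0 < C" and le: "\<And>l. box_count k l A \<le> C * box_count k l B"
  shows "upper_box_dim k A \<le> upper_box_dim k B" "lower_box_dim k A \<le> lower_box_dim k B"
proof -
  define err where "err l = ereal (ln (real C) / (real l * ln (real k)))" for l
  have ratio: "box_ratio k l A \<le> err l + box_ratio k l B" for l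
  proof (cases "box_count k l A = 0")
    case True
    then show ?thesis
      by (simp add: box_ratio_def)
  next
    case False
    then have pos: "0 < box_count k l A" "0 < box_count k l B"
      using le[of l] by (auto intro!: gr0I)
    have "real (box_count k l A) \<le> real C * real (box_count k l B)"
      using le[of l] by (metis of_nat_le_iff of_nat_mult)
    then have "ln (real (box_count k l A)) \<le> ln (real C * real (box_count k l B))"
      using pos by (subst ln_le_cancel_iff) (auto intro!: mult_pos_pos \<open>0 < C\<close>)
    also have "\<dots> = ln (real C) + ln (real (box_count k l B))"
      using pos \<open>0 < C\<close> by (simp add: ln_mult)
    finally have "ln (real (box_count k l A)) / (real l * ln (real k)) \<le>
        ln (real C) / (real l * ln (real k)) + ln (real (box_count k l B)) / (real l * ln (real k))"
      using \<open>2 \<le> k\<close> by (simp add: divide_right_mono flip: add_divide_distrib)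
    then show ?thesis
      using pos by (simp add: box_ratio_def err_def)
  qed
  have "(\<lambda>l. ln (real C) / ln (real k) * (1 / real l)) \<longlonglongrightarrow> ln (real C) / ln (real k) * 0"
    by (intro tendsto_intros lim_1_over_n)
  then have "err \<longlonglongrightarrow> 0"
    unfolding err_def zero_ereal_def by (simp add: mult.commute)
  then have "limsup (\<lambda>l. err l + box_ratio k l B) = 0 + limsup (\<lambda>l. box_ratio k l B)"
    and "liminf (\<lambda>l. err l + box_ratio k l B) = 0 + liminf (\<lambda>l. box_ratio k l B)"
    by (rule ereal_limsup_lim_add ereal_liminf_lim_add; simp)+
  moreover have "limsup (\<lambda>l. box_ratio k l A) \<le> limsup (\<lambda>l. err l + box_ratio k l B)"
    and "liminf (\<lambda>l. box_ratio k l A) \<le> liminf (\<lambda>l. err l + box_ratio k l B)"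
    using ratio by (auto intro!: Limsup_mono Liminf_mono always_eventually)
  ultimately show "upper_box_dim k A \<le> upper_box_dim k B" "lower_box_dim k A \<le> lower_box_dim k B"
    by (simp_all add: upper_box_dim_def lower_box_dim_def)
qed

section \<open>Hausdorff dimension\<close>

text \<open>
  Each isolated point is the only point of \<open>A\<close> in some member of a countable base.
\<close>

lemma countable_isolated_points:
  fixes A :: "'a::second_countable_topology set"
  shows "countable {x \<in> A. \<not> x islimpt A}"
proof -
  obtain \<B> :: "'a set set" where \<B>: "countable \<B>"
      "\<And>C. C \<in> \<B> \<Longrightarrow> open C" "\<And>S. open S \<Longrightarrow> \<exists>U. U \<subseteq> \<B> \<and> S = \<Union>U"
    using univ_second_countable by blast
  have "{x \<in> A. \<not> x islimpt A} \<subseteq> (\<lambda>V. the_elem (V \<inter> A)) ` \<B>"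
  proof
    fix x
    assume "x \<in> {x \<in> A. \<not> x islimpt A}"
    then obtain S where "x \<in> A" "open S" "x \<in> S" and only_x: "\<And>y. y \<in> A \<Longrightarrow> y \<in> S \<Longrightarrow> y = x"
      by (auto simp: islimpt_def)
    with \<B>(3)[of S] obtain V where "V \<in> \<B>" "x \<in> V" "V \<subseteq> S"
      by blast
    then have "V \<inter> A = {x}"
      using \<open>x \<in> A\<close> only_x by blast
    then show "x \<in> (\<lambda>V. the_elem (V \<inter> A)) ` \<B>"
      using \<open>V \<in> \<B>\<close> by (intro image_eqI[of _ _ V]) auto
  qed
  then show ?thesis
    by (rule countable_subset[OF _ countable_image[OF \<B>(1)]])
qed

text \<open>
  A cover of \<open>B\<close> becomes a cover of \<open>A\<close> when singletons are added for the countably many missing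
  points. Singletons have diameter \<open>0\<close>, and \<open>0 powr s = 0\<close>, so the sum does not change.
\<close>

lemma hausdorff_content_le_of_countable_diff:
  assumes "countable (A - B)" "0 \<le> \<delta>"
  shows "hausdorff_content s \<delta> A \<le> hausdorff_content s \<delta> B"
  unfolding hausdorff_content_def
proof (rule INF_mono)
  fix U
  assume U: "U \<in> {U. B \<subseteq> (\<Union>i::nat. U i) \<and> (\<forall>i. bounded (U i) \<and> diameter (U i) \<le> \<delta>)}"
  define c where "c = from_nat_into (A - B)"
  have c: "A - B \<subseteq> range c"
    unfolding c_def using assms(1) by (rule subset_range_from_nat_into)
  \<comment> \<open>The given sets at even indices, the added singletons at odd ones. If \<open>A - B\<close> is empty,
    the sequence \<open>c\<close> takes an arbitrary value, which does no harm.\<close>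
  define V where "V n = (if even n then U (n div 2) else {c (n div 2)})" for n
  have even: "V (2 * i) = U i" and odd: "V (2 * i + 1) = {c i}" for i
    by (auto simp: V_def)
  have "A \<subseteq> (\<Union>n. V n)"
  proof
    fix x
    assume "x \<in> A"
    then have "x \<in> (\<Union>i. U i) \<or> x \<in> range c"
      using U c by auto
    then consider i where "x \<in> U i" | i where "x = c i"
      by auto
    then show "x \<in> (\<Union>n. V n)"
    proof cases
      case (1 i)
      then show ?thesis
        using even[of i] by (intro UN_I[of "2 * i"]) auto
    next
      case (2 i)
      then show ?thesis
        using odd[of i] by (intro UN_I[of "2 * i + 1"]) auto
    qed
  qed
  moreover have "bounded (V n) \<and> diameter (V n) \<le> \<delta>" for n
    using U \<open>0 \<le> \<delta>\<close> by (auto simp: V_def)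
  moreover have "(\<Sum>i. ennreal (diameter (V (2 * i)) powr s)) = (\<Sum>n. ennreal (diameter (V n) powr s))"
  proof (rule suminf_mono_reindex)
    show "strict_mono ((*) (2::nat))"
      by (simp add: strict_mono_def)
    show "ennreal (diameter (V n) powr s) = 0" if "n \<notin> range ((*) 2)" for n
      using that by (auto simp: V_def elim!: evenE)
  qed
  ultimately show "\<exists>V\<in>{V. A \<subseteq> (\<Union>i::nat. V i) \<and> (\<forall>i. bounded (V i) \<and> diameter (V i) \<le> \<delta>)}.
      (\<Sum>i. ennreal (diameter (V i) powr s)) \<le> (\<Sum>i. ennreal (diameter (U i) powr s))"
    by (intro bexI[of _ V]) (auto simp: even)
qed

lemma hausdorff_dim_le_of_countable_diff:
  assumes "countable (A - B)"
  shows "hausdorff_dim A \<le> hausdorff_dim B"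
proof -
  have le: "hausdorff_measure s A \<le> hausdorff_measure s B" for s
    unfolding hausdorff_measure_def
  proof (rule SUP_mono)
    show "\<exists>\<epsilon>\<in>{0<..}. hausdorff_content s \<delta> A \<le> hausdorff_content s \<epsilon> B" if "\<delta> \<in> {0<..}" for \<delta>
      using that by (intro bexI[of _ \<delta>] hausdorff_content_le_of_countable_diff[OF assms]) auto
  qed
  have "hausdorff_measure s A = 0" if "hausdorff_measure s B = 0" for s
    using le[of s] that by simp
  then show ?thesis
    unfolding hausdorff_dim_def by (intro INF_superset_mono) auto
qed

lemma hausdorff_dim_le_secant_points: "hausdorff_dim A \<le> hausdorff_dim (secant_points f f' A)"
proof (rule hausdorff_dim_le_of_countable_diff)
  show "countable (A - secant_points f f' A)"
    by (rule countable_subset[OF _ countable_isolated_points[of A]]) (auto simp: secant_points_def)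
qed

section \<open>Large sets with a monotone derivative\<close>

lemma box_dims_le_secant_points:
  fixes f f' :: "real \<Rightarrow> real"
  assumes deriv: "\<And>x. x \<in> {l..r} \<Longrightarrow> (f has_real_derivative f' x) (at x within {l..r})"
    and "A \<subseteq> {l..r}" "x \<in> A" "y \<in> A" "x < y" "2 \<le> k"
  shows "upper_box_dim k A \<le> upper_box_dim k (secant_points f f' A)"
    and "lower_box_dim k A \<le> lower_box_dim k (secant_points f f' A)"
proof -
  note between = secant_points_between[OF deriv \<open>A \<subseteq> {l..r}\<close>]
  have "bounded A" "bounded (secant_points f f' A)"
    using \<open>A \<subseteq> {l..r}\<close> secant_points_subset bounded_closed_interval bounded_subset by metis+
  moreover have "secant_points f f' A \<noteq> {}"
    using between[OF _ \<open>x \<in> A\<close> \<open>y \<in> A\<close> \<open>x < y\<close>] by blast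
  ultimately have "box_count k n A \<le> 6 * box_count k n (secant_points f f' A)" for n
    using between \<open>2 \<le> k\<close> by (intro box_count_le_of_interleaved) auto
  then show "upper_box_dim k A \<le> upper_box_dim k (secant_points f f' A)"
    and "lower_box_dim k A \<le> lower_box_dim k (secant_points f f' A)"
    using box_dims_le_of_box_count_le[OF \<open>2 \<le> k\<close>, of 6] by auto
qed

lemma exists_large_mono_on_derivative:
  fixes f f' :: "real \<Rightarrow> real"
  assumes deriv: "\<And>x. x \<in> {l..r} \<Longrightarrow> (f has_real_derivative f' x) (at x within {l..r})"
    and "continuous_on {l..r} f'" "A \<subseteq> {l..r}" "slope_convex_on A f"
  shows "\<exists>B \<subseteq> {l..r}. mono_on B f' \<and> hausdorff_dim B \<ge> hausdorff_dim A \<and>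
           (\<forall>k\<ge>2. upper_box_dim k B \<ge> upper_box_dim k A \<and>
                  lower_box_dim k B \<ge> lower_box_dim k A)"
proof (cases "\<exists>x\<in>A. \<exists>y\<in>A. x < y")
  case True
  then show ?thesis
    using secant_points_subset[OF assms(3)] mono_on_secant_points[OF assms]
      hausdorff_dim_le_secant_points box_dims_le_secant_points[OF deriv assms(3)]
    by (intro exI[of _ "secant_points f f' A"]) blast
next
  case False
  then have "mono_on A f'"
    by (intro mono_onI) (metis order.order_iff_strict)
  then show ?thesis
    using \<open>A \<subseteq> {l..r}\<close> by blast
qed

theorem lemma9:
  fixes f f' :: "real \<Rightarrow> real" and A :: "real set"
  assumes "\<And>x. x \<in> {0..1} \<Longrightarrow> (f has_real_derivative f' x) (at x within {0..1})"
    and "continuous_on {0..1} f'"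
    and "A \<subseteq> {0..1}"
    and "slope_convex_on A f \<or> slope_concave_on A f"
  shows "\<exists>B \<subseteq> {0..1}.
           (mono_on B f' \<or> antimono_on B f') \<and>
           hausdorff_dim B \<ge> hausdorff_dim A \<and>
           (\<forall>k\<ge>2. upper_box_dim k B \<ge> upper_box_dim k A \<and>
                  lower_box_dim k B \<ge> lower_box_dim k A)"
  using assms(4)
proof
  assume "slope_convex_on A f"
  from exists_large_mono_on_derivative[OF assms(1-3) this] show ?thesis
    by blast
next
  assume concave: "slope_concave_on A f"
  have "slope_convex_on A (\<lambda>x. - f x)"
    unfolding slope_convex_on_def
  proof (intro ballI impI)
    fix x1 x2 x3
    assume "x1 \<in> A" "x2 \<in> A" "x3 \<in> A" "x1 < x2" "x2 < x3"
    then have "(f x3 - f x2) / (x3 - x2) \<le> (f x2 - f x1) / (x2 - x1)"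
      using concave by (simp add: slope_concave_on_def)
    then show "(- f x2 - - f x1) / (x2 - x1) \<le> (- f x3 - - f x2) / (x3 - x2)"
      by (simp add: diff_divide_distrib)
  qed
  moreover have "((\<lambda>x. - f x) has_real_derivative - f' x) (at x within {0..1})"
    if "x \<in> {0..1}" for x
    using assms(1)[OF that] by (rule DERIV_minus)
  moreover have "continuous_on {0..1} (\<lambda>x. - f' x)"
    using assms(2) by (rule continuous_on_minus)
  moreover have "antimono_on B f'" if "mono_on B (\<lambda>x. - f' x)" for B
    using that by (simp add: monotone_on_def)
  ultimately show ?thesis
    using exists_large_mono_on_derivative[of 0 1 "\<lambda>x. - f x" "\<lambda>x. - f' x" A] assms(3) by blast
qed

end
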